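(* Let $M\ge1$ be an integer, let $\beta_0,\dots,\beta_M$ be the coefficients of the $M$-step Adams--Moulton scheme, and for $N\ge M$ let $B_h\in\mathbb{R}^{(N-M+1)\times(N+1)}$ be its non-auxiliary discovery matrix. Let $p_{\rm AM}(z)=\beta_0z^M+\beta_1z^{M-1}+\cdots+\beta_{M-1}z+\beta_M$ and suppose that $$p_{\rm AM}(\lambda)\ne0\quad\text{for every }\lambda\in\mathbb{C}\text{ with }|\lambda|=1 .$$ Set (with $\max\emptyset=0$) $$\rho_{\rm AM}:=\max\Big\{\max_{p_{\rm AM}(\lambda)=0,\ |\lambda|<1}|\lambda|,\ \max_{p_{\rm AM}(\lambda)=0,\ |\lambda|>1}|\lambda|^{-1}\Big\}.$$ Then, for every $\theta\in(\rho_{\rm AM},1)$, there exists a constant $C>0$, independent of $N$, such that every $d=(d_0,\ldots,d_N)^\top\in\ker(B_h)$ satisfies $$|d_i|\le C\Big(\theta^i\sum_{j=0}^{M-1}|d_j|+\theta^{N-i}\sum_{j=N-M+1}^{N}|d_j|\Big),\qquad i=0,\ldots,N.$$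
   Context: The $M$-step Adams--Moulton (A-M) scheme for $\dot x=f$ on a uniform grid of step $h$ is the classical implicit linear multistep method $x_n-x_{n-1}=h\sum_{m=0}^M\beta_m f_{n-m}$ (so $\alpha_0=1$, $\alpha_1=-1$, the other $\alpha_m=0$), with real coefficients $$\beta_m=\frac{(-1)^{m}}{m!\,(M-m)!}\int_0^1\prod_{i=0,\ i\ne m}^{M}(u+i-1)\,du,\qquad m=0,\dots,M;$$ in particular $\beta_0\ne0$. Non-auxiliary A-M discovery matrix: for $N\ge M$, $B_h\in\mathbb{R}^{(N-M+1)\times(N+1)}$ acts on $d=(d_0,\ldots,d_N)^\top\in\mathbb{R}^{N+1}$ by $(B_hd)_n=\sum_{m=0}^M\beta_m d_{n-m}$, the rows being indexed by $n=M,\ldots,N$. Hence $d\in\ker(B_h)$ if and only if $\sum_{m=0}^M\beta_m d_{n-m}=0$ for all $n=M,\ldots,N$. (The entries of $B_h$ do not depend on $h$; only its size depends on $N$.) *)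

theory Defs
  imports
    "HOL-Analysis.Henstock_Kurzweil_Integration"
    "Jordan_Normal_Form.Matrix_Kernel"
begin

definition am_beta :: "nat \<Rightarrow> nat \<Rightarrow> real" where
  "am_beta M m = (-1) ^ m / (fact m * fact (M - m)) *
     integral {0..1} (\<lambda>u::real. \<Prod>i\<in>{0..M} - {m}. (u + real i - 1))"

definition am_poly :: "nat \<Rightarrow> complex poly" where
  "am_poly M = (\<Sum>m\<le>M. monom (complex_of_real (am_beta M m)) (M - m))"

(* Matrix rows are numbered from 0, so row r stands for the grid index n = r + M and
   the entry in column j is beta_(n-j).  The entries do not depend on the step size h. *)
definition am_matrix :: "nat \<Rightarrow> nat \<Rightarrow> real mat" where
  "am_matrix M N = mat (N - M + 1) (N + 1)
     (\<lambda>(r, j). if r \<le> j \<and> j \<le> r + M then am_beta M (r + M - j) else 0)"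

(* Max {} is unspecified in HOL; the convention here is max {} = 0. *)
definition max0 :: "real set \<Rightarrow> real" where
  "max0 S = (if S = {} then 0 else Max S)"

definition am_rho :: "nat \<Rightarrow> real" where
  "am_rho M = max
     (max0 {cmod z |z. poly (am_poly M) z = 0 \<and> cmod z < 1})
     (max0 {inverse (cmod z) |z. poly (am_poly M) z = 0 \<and> cmod z > 1})"

lemma poly_am_poly:
  "poly (am_poly M) z = (\<Sum>m\<le>M. complex_of_real (am_beta M m) * z ^ (M - m))"
  by (simp add: am_poly_def poly_sum poly_monom)

lemma am_matrix_carrier: "am_matrix M N \<in> carrier_mat (N - M + 1) (N + 1)"
  by (simp add: am_matrix_def)

lemma am_matrix_mult_vec:
  assumes "M \<le> N" "d \<in> carrier_vec (N + 1)" "n \<in> {M..N}"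
  shows "(am_matrix M N *\<^sub>v d) $ (n - M) = (\<Sum>m\<le>M. am_beta M m * d $ (n - m))"
proof -
  have "(am_matrix M N *\<^sub>v d) $ (n - M)
      = (\<Sum>j\<in>{0..<N + 1}. (if n - M \<le> j \<and> j \<le> n then am_beta M (n - j) else 0) * d $ j)"
  proof -
    have r: "n - M < N - M + 1" and "M \<le> n" using assms(1,3) by auto
    show ?thesis
      using r \<open>M \<le> n\<close> assms(2)
      by (auto simp add: am_matrix_def scalar_prod_def simp del: sum.op_ivl_Suc intro!: sum.cong)
  qed
  also have "\<dots> = (\<Sum>j\<in>{n - M..n}. am_beta M (n - j) * d $ j)"
    by (rule sum.mono_neutral_cong_right) (use assms in auto)
  also have "\<dots> = (\<Sum>m\<le>M. am_beta M m * d $ (n - m))"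
    by (rule sum.reindex_bij_witness[of _ "\<lambda>m. n - m" "\<lambda>j. n - j"]) (use assms in auto)
  finally show ?thesis .
qed

lemma mat_kernel_am_matrix_iff:
  assumes "M \<le> N"
  shows "d \<in> mat_kernel (am_matrix M N) \<longleftrightarrow>
    d \<in> carrier_vec (N + 1) \<and> (\<forall>n\<in>{M..N}. (\<Sum>m\<le>M. am_beta M m * d $ (n - m)) = 0)"
proof -
  have "am_matrix M N *\<^sub>v d = 0\<^sub>v (N - M + 1) \<longleftrightarrow>
      (\<forall>n\<in>{M..N}. (am_matrix M N *\<^sub>v d) $ (n - M) = 0)" (is "?L \<longleftrightarrow> ?R")
  proof
    assume ?L
    then show ?R by auto
  next
    assume R: ?R
    show ?L
    proof (rule eq_vecI)
      fix r assume "r < dim_vec (0\<^sub>v (N - M + 1) :: real vec)"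
      then have r: "r < N - M + 1" by simp
      with assms have "r + M \<in> {M..N}" by auto
      with R have "(am_matrix M N *\<^sub>v d) $ (r + M - M) = 0" by blast
      with r show "(am_matrix M N *\<^sub>v d) $ r = 0\<^sub>v (N - M + 1) $ r" by simp
    qed (simp add: am_matrix_def)
  qed
  moreover have "?R \<longleftrightarrow> (\<forall>n\<in>{M..N}. (\<Sum>m\<le>M. am_beta M m * d $ (n - m)) = 0)"
    if "d \<in> carrier_vec (N + 1)"
    by (rule ball_cong[OF refl]) (simp only: am_matrix_mult_vec[OF assms that])
  ultimately show ?thesis
    unfolding mat_kernel[OF am_matrix_carrier] by blast
qed

end

theory Submission
  imports
    Defs
    "HOL-Computational_Algebra.Fundamental_Theorem_Algebra"
begin

text \<open>
  Extend \<open>d\<close> by zero to a finitely supported sequence on the integers and let \<open>p(S)\<close> act on it,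
  where \<open>S\<close> is the shift and \<open>p\<close> the characteristic polynomial. Membership in the kernel says that
  \<open>p(S) d\<close> vanishes at every position where the stencil lies inside \<open>{0..N}\<close>. What is left of
  \<open>p(S) d\<close> sits, at each end of the grid, on the \<open>M\<close> positions where the stencil crosses that end,
  and there it is controlled by the \<open>M\<close> values of \<open>d\<close> next to it. It remains to invert \<open>p(S)\<close> with a decay
  estimate that does not see \<open>N\<close>.

  The inversion (lemma \<open>wnorm_le_shift_poly\<close>) takes place in \<open>\<ell>\<^sup>1\<close> with a weight \<open>w\<close> whose
  neighbouring values have ratio between \<open>\<theta>\<close> and \<open>1/\<theta>\<close>. On that space \<open>S\<close> and its inverse have norm
  at most \<open>1/\<theta>\<close>, so \<open>S - a\<close> is bounded below as soon as \<open>|a| < \<theta>\<close> or \<open>|a| > 1/\<theta>\<close>; this holds for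
  each root of \<open>p\<close>, and the linear factors are inverted one after the other. The bound depends on
  \<open>w\<close> only through \<open>\<theta>\<close>, so the weight can be chosen for each index \<open>i\<close> separately: with
  \<open>w n = \<theta>\<^bsup>|i - n|\<^esup>\<close> the value \<open>|d i|\<close> is at most the weighted norm of \<open>d\<close>, while the two groups of
  boundary terms carry weights of order \<open>\<theta>\<^bsup>i\<^esup>\<close> and \<open>\<theta>\<^bsup>N - i\<^esup>\<close>. Multiple roots need no special
  treatment: composing the bounds of several factors never changes the weight, whereas composing
  geometric convolution kernels would bring in powers of \<open>|i - n|\<close>.
\<close>

section \<open>Weighted norms of finitely supported sequences\<close>

definition wnorm :: "(int \<Rightarrow> real) \<Rightarrow> (int \<Rightarrow> complex) \<Rightarrow> real" where
  "wnorm w f = (\<Sum>n | f n \<noteq> 0. w n * norm (f n))"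

lemma wnorm_eq_sum:
  assumes "finite A" "\<And>n. n \<notin> A \<Longrightarrow> f n = 0"
  shows "wnorm w f = (\<Sum>n\<in>A. w n * norm (f n))"
  unfolding wnorm_def by (rule sum.mono_neutral_left) (use assms in auto)

lemma wnorm_cmult:
  assumes "finite {n. f n \<noteq> 0}"
  shows "wnorm w (\<lambda>n. a * f n) = norm a * wnorm w f"
proof -
  have "wnorm w (\<lambda>n. a * f n) = (\<Sum>n | f n \<noteq> 0. w n * norm (a * f n))"
    by (rule wnorm_eq_sum) (use assms in auto)
  then show ?thesis
    by (simp add: wnorm_def norm_mult sum_distrib_left mult.left_commute)
qed

lemma wnorm_triangle:
  assumes "finite {n. g n \<noteq> 0}" "finite {n. h n \<noteq> 0}"
    and w: "\<And>n. 0 \<le> w n"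
    and le: "\<And>n. norm (f n) \<le> norm (g n) + norm (h n)"
  shows "wnorm w f \<le> wnorm w g + wnorm w h"
proof -
  define A where "A = {n. g n \<noteq> 0} \<union> {n. h n \<noteq> 0}"
  have A: "finite A" using assms by (simp add: A_def)
  have g: "n \<notin> A \<Longrightarrow> g n = 0" and h: "n \<notin> A \<Longrightarrow> h n = 0" for n
    by (auto simp: A_def)
  have f: "f n = 0" if "n \<notin> A" for n
    using le[of n] g[OF that] h[OF that] by simp
  have "(\<Sum>n\<in>A. w n * norm (f n)) \<le> (\<Sum>n\<in>A. w n * (norm (g n) + norm (h n)))"
    by (intro sum_mono mult_left_mono le w)
  then show ?thesis
    by (simp add: wnorm_eq_sum[OF A f] wnorm_eq_sum[OF A g] wnorm_eq_sum[OF A h]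
        distrib_left sum.distrib)
qed

lemma finite_support_shift:
  fixes f :: "int \<Rightarrow> 'a::zero"
  assumes "finite {n. f n \<noteq> 0}"
  shows "finite {n. f (n + k) \<noteq> 0}"
proof -
  have "{n. f (n + k) \<noteq> 0} = (\<lambda>n. n - k) ` {n. f n \<noteq> 0}"
    by (force simp: image_iff intro: exI[of _ "_ + k"])
  then show ?thesis using assms by simp
qed

lemma wnorm_shift: "wnorm w (\<lambda>n. f (n + 1)) = wnorm (\<lambda>n. w (n - 1)) f"
  unfolding wnorm_def
  by (rule sum.reindex_bij_witness[of _ "\<lambda>n. n - 1" "\<lambda>n. n + 1"]) auto

text \<open>
  A weight that is logarithmically Lipschitz with constant \<open>- ln \<theta>\<close>. This makes the shift and its
  inverse bounded by \<open>1/\<theta>\<close>.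
\<close>

definition slow_weight :: "real \<Rightarrow> (int \<Rightarrow> real) \<Rightarrow> bool" where
  "slow_weight \<theta> w \<longleftrightarrow>
     (\<forall>n. 0 \<le> w n \<and> \<theta> * w n \<le> w (n - 1) \<and> \<theta> * w (n - 1) \<le> w n)"

lemma slow_weight_shift_bounds:
  assumes "slow_weight \<theta> w"
  shows "\<theta> * wnorm w f \<le> wnorm w (\<lambda>n. f (n + 1))"
    and "\<theta> * wnorm w (\<lambda>n. f (n + 1)) \<le> wnorm w f"
  using assms unfolding wnorm_shift unfolding slow_weight_def wnorm_def sum_distrib_left
  by (auto simp: mult.assoc[symmetric] intro!: sum_mono mult_right_mono)

section \<open>Inverting polynomials in the shift\<close>

definition shift_poly :: "complex poly \<Rightarrow> (int \<Rightarrow> complex) \<Rightarrow> int \<Rightarrow> complex" where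
  "shift_poly p f n = (\<Sum>k\<le>degree p. coeff p k * f (n + int k))"

lemma shift_poly_eq_sum:
  assumes "degree p \<le> K"
  shows "shift_poly p f n = (\<Sum>k\<le>K. coeff p k * f (n + int k))"
  unfolding shift_poly_def
  by (rule sum.mono_neutral_left) (use assms in \<open>auto simp: coeff_eq_0\<close>)

lemma shift_poly_linear_factor:
  "shift_poly ([:- a, 1:] * q) f n = shift_poly q f (n + 1) - a * shift_poly q f n"
proof -
  define K where "K = degree q"
  have "degree ([:- a, 1:] * q) \<le> Suc K"
    using degree_mult_le[of "[:- a, 1:]" q] by (simp add: K_def)
  moreover have "[:- a, 1:] * q = pCons 0 q - Polynomial.smult a q" by simp
  ultimately have "shift_poly ([:- a, 1:] * q) f n
      = (\<Sum>k\<le>Suc K. coeff (pCons 0 q) k * f (n + int k))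
        - a * (\<Sum>k\<le>Suc K. coeff q k * f (n + int k))"
    by (simp only: shift_poly_eq_sum coeff_diff coeff_smult left_diff_distrib
        sum_subtractf sum_distrib_left mult.assoc)
  also have "(\<Sum>k\<le>Suc K. coeff (pCons 0 q) k * f (n + int k)) = shift_poly q f (n + 1)"
    by (subst sum.atMost_Suc_shift) (simp add: shift_poly_def K_def add.assoc)
  also have "(\<Sum>k\<le>Suc K. coeff q k * f (n + int k)) = shift_poly q f n"
    by (rule shift_poly_eq_sum[symmetric]) (simp add: K_def)
  finally show ?thesis .
qed

lemma finite_support_shift_poly:
  assumes "finite {n. f n \<noteq> 0}"
  shows "finite {n. shift_poly p f n \<noteq> 0}"
proof (rule finite_subset)
  show "{n. shift_poly p f n \<noteq> 0} \<subseteq> (\<Union>k\<le>degree p. {n. f (n + int k) \<noteq> 0})"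
  proof clarify
    fix n assume "shift_poly p f n \<noteq> 0"
    then obtain k where "k \<in> {..degree p}" "coeff p k * f (n + int k) \<noteq> 0"
      unfolding shift_poly_def by (rule sum.not_neutral_contains_not_neutral)
    then show "n \<in> (\<Union>k\<le>degree p. {n. f (n + int k) \<noteq> 0})"
      by (intro UN_I) auto
  qed
  show "finite \<dots>"
    by (intro finite_UN_I finite_support_shift assms) simp
qed

text \<open>
  For small \<open>|a|\<close> the shift dominates in \<open>S - a\<close>, for large \<open>|a|\<close> the multiple of the identity does.
  The weighted norm of \<open>g\<close> appears on both sides of the triangle inequality and can be absorbed
  because finite support makes it finite.
\<close>

lemma wnorm_le_linear_factor:
  assumes \<theta>: "0 < \<theta>" and a: "norm a < \<theta> \<or> 1 / \<theta> < norm a"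
  obtains C where "C > 0"
    and "\<And>w g. slow_weight \<theta> w \<Longrightarrow> finite {n. g n \<noteq> 0} \<Longrightarrow>
           wnorm w g \<le> C * wnorm w (\<lambda>n. g (n + 1) - a * g n)"
proof -
  define \<delta> where "\<delta> = (if norm a < \<theta> then \<theta> - norm a else norm a - 1 / \<theta>)"
  have \<delta>: "\<delta> > 0" using a by (auto simp: \<delta>_def)
  have "\<delta> * wnorm w g \<le> wnorm w (\<lambda>n. g (n + 1) - a * g n)"
    if w: "slow_weight \<theta> w" and g: "finite {n. g n \<noteq> 0}" for w g
  proof -
    have w0: "0 \<le> w n" for n using w by (simp add: slow_weight_def)
    have g1: "finite {n. g (n + 1) \<noteq> 0}" by (rule finite_support_shift[OF g])
    have ga: "finite {n. a * g n \<noteq> 0}" by (rule finite_subset[OF _ g]) auto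
    let ?b = "\<lambda>n. g (n + 1) - a * g n"
    have b: "finite {n. ?b n \<noteq> 0}"
      by (rule finite_subset[OF _ finite_UnI[OF g1 ga]]) auto
    show ?thesis
    proof (cases "norm a < \<theta>")
      case True
      have "\<theta> * wnorm w g \<le> wnorm w (\<lambda>n. g (n + 1))"
        by (rule slow_weight_shift_bounds[OF w])
      also have "\<dots> \<le> wnorm w ?b + wnorm w (\<lambda>n. a * g n)"
        by (rule wnorm_triangle[OF b ga w0]) (metis diff_add_cancel norm_triangle_ineq)
      finally show ?thesis
        using True by (simp add: \<delta>_def wnorm_cmult[OF g] left_diff_distrib)
    next
      case False
      have "norm a * wnorm w g = wnorm w (\<lambda>n. a * g n)"
        by (simp add: wnorm_cmult[OF g])
      also have "\<dots> \<le> wnorm w (\<lambda>n. g (n + 1)) + wnorm w ?b"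
        by (rule wnorm_triangle[OF g1 b w0])
          (metis add_diff_cancel_left' diff_add_cancel norm_triangle_ineq4)
      also have "wnorm w (\<lambda>n. g (n + 1)) \<le> 1 / \<theta> * wnorm w g"
        using slow_weight_shift_bounds(2)[OF w, of g] \<theta> by (simp add: field_simps)
      finally show ?thesis
        using False by (simp add: \<delta>_def left_diff_distrib)
    qed
  qed
  with \<delta> have "wnorm w g \<le> 1 / \<delta> * wnorm w (\<lambda>n. g (n + 1) - a * g n)"
    if "slow_weight \<theta> w" "finite {n. g n \<noteq> 0}" for w g
    using that by (simp add: field_simps)
  with \<delta> show thesis by (intro that[of "1 / \<delta>"]) auto
qed

text \<open>
  The constant is the product of those of the linear factors. It is uniform in \<open>w\<close> and \<open>f\<close>, hence
  independent of the length of the support of \<open>f\<close>.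
\<close>

lemma wnorm_le_shift_poly:
  assumes \<theta>: "0 < \<theta>" and "p \<noteq> 0"
    and "\<And>a. poly p a = 0 \<Longrightarrow> norm a < \<theta> \<or> 1 / \<theta> < norm a"
  shows "\<exists>C>0. \<forall>w f. slow_weight \<theta> w \<longrightarrow> finite {n. f n \<noteq> 0} \<longrightarrow>
           wnorm w f \<le> C * wnorm w (shift_poly p f)"
  using assms(2,3)
proof (induction "degree p" arbitrary: p)
  case 0
  then obtain c where p: "p = [:c:]" "c \<noteq> 0"
    by (metis degree_eq_zeroE pCons_0_0)
  have "shift_poly p f = (\<lambda>n. c * f n)" for f
    by (simp add: p shift_poly_def fun_eq_iff)
  with p show ?case
    by (intro exI[of _ "1 / norm c"]) (auto simp: wnorm_cmult)
next
  case (Suc k)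
  then have "\<not> constant (poly p)" by (simp add: constant_degree)
  then obtain a where a: "poly p a = 0"
    using fundamental_theorem_of_algebra by blast
  then obtain q where p: "p = [:- a, 1:] * q"
    by (auto simp: poly_eq_0_iff_dvd)
  have "q \<noteq> 0" using p Suc.prems(1) by auto
  moreover have "k = degree q"
    using Suc.hyps(2) \<open>q \<noteq> 0\<close> unfolding p by (subst (asm) degree_mult_eq) auto
  moreover have "norm b < \<theta> \<or> 1 / \<theta> < norm b" if "poly q b = 0" for b
    by (rule Suc.prems(2)) (simp add: p that)
  ultimately obtain C where C: "C > 0" and
    C_le: "\<And>w f. slow_weight \<theta> w \<Longrightarrow> finite {n. f n \<noteq> 0} \<Longrightarrow>
      wnorm w f \<le> C * wnorm w (shift_poly q f)"
    using Suc.hyps(1)[of q] by blast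
  obtain D where D: "D > 0" and
    D_le: "\<And>w g. slow_weight \<theta> w \<Longrightarrow> finite {n. g n \<noteq> 0} \<Longrightarrow>
      wnorm w g \<le> D * wnorm w (\<lambda>n. g (n + 1) - a * g n)"
    using wnorm_le_linear_factor[OF \<theta> Suc.prems(2)[OF a]] by metis
  have "wnorm w f \<le> C * D * wnorm w (shift_poly p f)"
    if w: "slow_weight \<theta> w" and f: "finite {n. f n \<noteq> 0}" for w f
  proof -
    have "wnorm w (shift_poly q f) \<le> D * wnorm w (shift_poly p f)"
      using D_le[OF w finite_support_shift_poly[OF f, of q]]
      by (simp only: p shift_poly_linear_factor[symmetric])
    then have "C * wnorm w (shift_poly q f) \<le> C * (D * wnorm w (shift_poly p f))"
      using C by (intro mult_left_mono) auto
    with C_le[OF w f] show ?thesis by simp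
  qed
  with C D show ?case by (intro exI[of _ "C * D"]) auto
qed

section \<open>Decay from both ends of a finite recurrence\<close>

lemma slow_weight_power_dist:
  fixes i :: int
  assumes "0 < \<theta>" "\<theta> < 1"
  shows "slow_weight \<theta> (\<lambda>n. \<theta> ^ nat \<bar>i - n\<bar>)"
proof -
  have "\<theta> * \<theta> ^ nat \<bar>i - m\<bar> \<le> \<theta> ^ nat \<bar>i - n\<bar>" if "\<bar>m - n\<bar> \<le> 1" for m n
    unfolding power_Suc[symmetric]
    by (rule power_decreasing) (use assms that in auto)
  with assms show ?thesis by (simp add: slow_weight_def)
qed

text \<open>
  The weight is peaked at the index \<open>i\<close> under consideration, so a boundary term at position \<open>n\<close>
  reaches \<open>x i\<close> only with the factor \<open>\<theta>\<^bsup>|i - n|\<^esup>\<close>. Boundary terms lie within distance \<open>K\<close> of an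
  end, and replacing \<open>n\<close> by that end costs at most \<open>\<theta>\<^bsup>-K\<^esup>\<close>, which goes into the constant.
\<close>

lemma recurrence_two_sided_decay:
  fixes p :: "complex poly"
  assumes \<theta>: "0 < \<theta>" "\<theta> < 1" and "p \<noteq> 0"
    and roots: "\<And>a. poly p a = 0 \<Longrightarrow> norm a < \<theta> \<or> 1 / \<theta> < norm a"
    and K: "degree p \<le> K"
  obtains C where "C > 0"
    and "\<And>N (x :: nat \<Rightarrow> complex) i. K \<le> N \<Longrightarrow>
           (\<And>n. n \<le> N - K \<Longrightarrow> (\<Sum>k\<le>K. coeff p k * x (n + k)) = 0) \<Longrightarrow> i \<le> N \<Longrightarrow>
           norm (x i) \<le> C * (\<theta> ^ i * (\<Sum>j<K. norm (x j))
                           + \<theta> ^ (N - i) * (\<Sum>j=N - K + 1..N. norm (x j)))"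
proof -
  obtain C where C: "C > 0" and
    C_le: "\<And>w f. slow_weight \<theta> w \<Longrightarrow> finite {n. f n \<noteq> 0} \<Longrightarrow>
      wnorm w f \<le> C * wnorm w (shift_poly p f)"
    using wnorm_le_shift_poly[OF \<theta>(1) \<open>p \<noteq> 0\<close> roots] by blast
  define B where "B = (\<Sum>k\<le>K. norm (coeff p k))"
  have B: "B \<ge> 0" by (simp add: B_def sum_nonneg)
  define E where "E = C * (real K * B / \<theta> ^ K)"
  have E: "E \<ge> 0" using C B \<theta> by (simp add: E_def)
  have "norm (x i) \<le> E * (\<theta> ^ i * (\<Sum>j<K. norm (x j))
                        + \<theta> ^ (N - i) * (\<Sum>j=N - K + 1..N. norm (x j)))"
    if N: "K \<le> N" and rec: "\<And>n. n \<le> N - K \<Longrightarrow> (\<Sum>k\<le>K. coeff p k * x (n + k)) = 0" and i: "i \<le> N"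
    for N i and x :: "nat \<Rightarrow> complex"
  proof -
    define L R where "L = (\<Sum>j<K. norm (x j))" and "R = (\<Sum>j=N - K + 1..N. norm (x j))"
    have LR: "0 \<le> L" "0 \<le> R" by (simp_all add: L_def R_def sum_nonneg)
    define f where "f n = (if 0 \<le> n \<and> n \<le> int N then x (nat n) else 0)" for n
    define b where "b = shift_poly p f"
    define w where "w n = \<theta> ^ nat \<bar>int i - n\<bar>" for n
    have w: "slow_weight \<theta> w"
      unfolding w_def by (rule slow_weight_power_dist[OF \<theta>])
    have f: "finite {n. f n \<noteq> 0}"
      by (rule finite_subset[of _ "{0..int N}"]) (auto simp: f_def split: if_splits)
    have b_eq: "b n = (\<Sum>k\<le>K. coeff p k * f (n + int k))" for n
      unfolding b_def by (rule shift_poly_eq_sum[OF K])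
    have b_le: "norm (b n) \<le> B * D" if "\<And>k. k \<le> K \<Longrightarrow> norm (f (n + int k)) \<le> D" for n D
      unfolding b_eq B_def sum_distrib_right
      by (rule sum_norm_le) (auto simp: norm_mult intro!: mult_left_mono that)

    \<comment> \<open>The stencil at \<open>n\<close> covers \<open>n, \<dots>, n + K\<close>: it overhangs the left end for \<open>-K \<le> n < 0\<close> and the
        right end for \<open>N - K < n \<le> N\<close>.\<close>
    define I J where "I = {- int K..-1}" and "J = {int (N - K) + 1..int N}"
    have left: "norm (b n) \<le> B * L" if "n \<in> I" for n
    proof (rule b_le)
      fix k assume "k \<le> K"
      show "norm (f (n + int k)) \<le> L"
      proof (cases "0 \<le> n + int k")
        case True
        have "norm (x (nat (n + int k))) \<le> L"
          unfolding L_def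
          by (rule member_le_sum[of _ _ "\<lambda>j. norm (x j)"])
            (use True that \<open>k \<le> K\<close> in \<open>auto simp: I_def\<close>)
        with LR show ?thesis by (simp add: f_def)
      qed (use LR in \<open>simp add: f_def\<close>)
    qed
    have right: "norm (b n) \<le> B * R" if "n \<in> J" for n
    proof (rule b_le)
      fix k assume "k \<le> K"
      show "norm (f (n + int k)) \<le> R"
      proof (cases "n + int k \<le> int N")
        case True
        have "norm (x (nat (n + int k))) \<le> R"
          unfolding R_def
          by (rule member_le_sum[of _ _ "\<lambda>j. norm (x j)"])
            (use True that \<open>k \<le> K\<close> N in \<open>auto simp: J_def\<close>)
        with LR show ?thesis by (simp add: f_def)
      qed (use LR in \<open>simp add: f_def\<close>)
    qed
    have b0: "b n = 0" if "n \<notin> I \<union> J" for n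
    proof (cases "0 \<le> n \<and> n \<le> int (N - K)")
      case True
      then have "b n = (\<Sum>k\<le>K. coeff p k * x (nat n + k))"
        unfolding b_eq
        by (intro sum.cong) (use N in \<open>auto simp: f_def nat_add_distrib\<close>)
      with True rec show ?thesis by (simp add: nat_le_iff)
    next
      case False
      with that N have "f (n + int k) = 0" if "k \<le> K" for k
        using \<open>k \<le> K\<close> by (auto simp: f_def I_def J_def)
      then show ?thesis by (simp add: b_eq)
    qed

    have wI: "w n \<le> \<theta> ^ i / \<theta> ^ K" if "n \<in> I" for n
    proof -
      have "\<theta> ^ (nat \<bar>int i - n\<bar> + K) \<le> \<theta> ^ i"
        by (rule power_decreasing) (use that \<theta> in \<open>auto simp: I_def\<close>)
      with \<theta> show ?thesis by (simp add: w_def power_add field_simps)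
    qed
    have wJ: "w n \<le> \<theta> ^ (N - i) / \<theta> ^ K" if "n \<in> J" for n
    proof -
      have "\<theta> ^ (nat \<bar>int i - n\<bar> + K) \<le> \<theta> ^ (N - i)"
        by (rule power_decreasing) (use that \<theta> N in \<open>auto simp: J_def\<close>)
      with \<theta> show ?thesis by (simp add: w_def power_add field_simps)
    qed

    have "norm (x i) = w (int i) * norm (f (int i))"
      using i by (simp add: w_def f_def)
    also have "\<dots> \<le> (\<Sum>n\<in>{0..int N}. w n * norm (f n))"
      by (rule member_le_sum[of _ _ "\<lambda>n. w n * norm (f n)"])
        (use i w in \<open>auto simp: slow_weight_def\<close>)
    also have "\<dots> = wnorm w f"
      by (rule wnorm_eq_sum[symmetric]) (auto simp: f_def)
    also have "\<dots> \<le> C * wnorm w b"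
      unfolding b_def by (rule C_le[OF w f])
    also have "wnorm w b = (\<Sum>n\<in>I \<union> J. w n * norm (b n))"
      by (rule wnorm_eq_sum) (simp_all add: I_def J_def b0[unfolded I_def J_def])
    also have "\<dots> = (\<Sum>n\<in>I. w n * norm (b n)) + (\<Sum>n\<in>J. w n * norm (b n))"
      by (rule sum.union_disjoint) (auto simp: I_def J_def)
    also have "\<dots> \<le> (\<Sum>n\<in>I. \<theta> ^ i / \<theta> ^ K * (B * L)) + (\<Sum>n\<in>J. \<theta> ^ (N - i) / \<theta> ^ K * (B * R))"
      by (intro add_mono sum_mono mult_mono wI wJ left right) (use \<theta> in auto)
    also have "\<dots> = real K * B / \<theta> ^ K * (\<theta> ^ i * L + \<theta> ^ (N - i) * R)"
      using N by (simp add: I_def J_def add_divide_distrib algebra_simps)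
    finally show ?thesis
      using C by (simp add: E_def L_def R_def mult.assoc)
  qed
  \<comment> \<open>\<open>E\<close> is zero when \<open>K = 0\<close>, hence the passage to \<open>E + 1\<close>.\<close>
  moreover have "E * (\<theta> ^ a * sum (\<lambda>j. norm (x j)) A + \<theta> ^ b * sum (\<lambda>j. norm (x j)) B)
      \<le> (E + 1) * (\<theta> ^ a * sum (\<lambda>j. norm (x j)) A + \<theta> ^ b * sum (\<lambda>j. norm (x j)) B)"
    for a b A B and x :: "nat \<Rightarrow> complex"
    by (rule mult_right_mono) (use \<theta> in \<open>auto intro!: add_nonneg_nonneg mult_nonneg_nonneg sum_nonneg\<close>)
  ultimately have E_le: "norm (x i) \<le> (E + 1) * (\<theta> ^ i * (\<Sum>j<K. norm (x j))
                        + \<theta> ^ (N - i) * (\<Sum>j=N - K + 1..N. norm (x j)))"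
    if "K \<le> N" "\<And>n. n \<le> N - K \<Longrightarrow> (\<Sum>k\<le>K. coeff p k * x (n + k)) = 0" "i \<le> N"
    for N i and x :: "nat \<Rightarrow> complex"
    using order_trans that by blast
  show thesis
  proof (rule that)
    show "0 < E + 1" using E by simp
  qed (fact E_le)
qed

section \<open>The Adams--Moulton discovery matrix\<close>

lemma coeff_am_poly:
  assumes "k \<le> M"
  shows "coeff (am_poly M) k = complex_of_real (am_beta M (M - k))"
proof -
  have "coeff (am_poly M) k
      = (\<Sum>m\<le>M. if m = M - k then complex_of_real (am_beta M m) else 0)"
    unfolding am_poly_def coeff_sum coeff_monom by (rule sum.cong) (use assms in auto)
  then show ?thesis by simp
qed

lemma degree_am_poly: "degree (am_poly M) \<le> M"
  unfolding am_poly_def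
  by (rule degree_sum_le) (auto intro: order_trans[OF degree_monom_le])

lemma am_kernel_recurrence:
  assumes "M \<le> N" "d \<in> mat_kernel (am_matrix M N)" "n \<le> N - M"
  shows "(\<Sum>k\<le>M. coeff (am_poly M) k * complex_of_real (d $ (n + k))) = 0"
proof -
  have "(\<Sum>k\<le>M. coeff (am_poly M) k * complex_of_real (d $ (n + k)))
      = (\<Sum>k\<le>M. complex_of_real (am_beta M (M - k) * d $ (n + k)))"
    by (intro sum.cong) (auto simp: coeff_am_poly)
  also have "\<dots> = complex_of_real (\<Sum>m\<le>M. am_beta M m * d $ (n + M - m))"
    unfolding of_real_sum
    by (rule sum.reindex_bij_witness[of _ "\<lambda>m. M - m" "\<lambda>k. M - k"]) auto
  also have "\<dots> = 0"
    using assms by (simp add: mat_kernel_am_matrix_iff)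
  finally show ?thesis .
qed

lemma max0_ge: "finite S \<Longrightarrow> x \<in> S \<Longrightarrow> x \<le> max0 S"
  by (auto simp: max0_def)

lemma am_rho_nonneg:
  assumes "am_poly M \<noteq> 0"
  shows "0 \<le> am_rho M"
proof -
  let ?S = "{cmod z |z. poly (am_poly M) z = 0 \<and> cmod z < 1}"
  have "finite ?S"
    by (rule finite_subset[OF _ finite_imageI[OF poly_roots_finite[OF assms], of cmod]]) auto
  then have max_in: "Max ?S \<in> ?S" if "?S \<noteq> {}"
    using that by (rule Max_in)
  have "0 \<le> max0 ?S"
  proof (cases "?S = {}")
    case False
    from max_in[OF this] obtain z where "Max ?S = cmod z" by blast
    with False show ?thesis by (simp only: max0_def if_False norm_ge_zero)
  qed (simp add: max0_def)
  then show ?thesis by (simp add: am_rho_def)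
qed

lemma am_root_le_rho:
  assumes "am_poly M \<noteq> 0" "poly (am_poly M) z = 0"
  shows "cmod z < 1 \<Longrightarrow> cmod z \<le> am_rho M"
    and "cmod z > 1 \<Longrightarrow> inverse (cmod z) \<le> am_rho M"
proof -
  note fin = finite_imageI[OF poly_roots_finite[OF assms(1)]]
  show "cmod z \<le> am_rho M" if "cmod z < 1"
    unfolding am_rho_def
    by (rule max.coboundedI1, rule max0_ge, rule finite_subset[OF _ fin[of cmod]])
      (use assms that in auto)
  show "inverse (cmod z) \<le> am_rho M" if "cmod z > 1"
    unfolding am_rho_def
    by (rule max.coboundedI2, rule max0_ge,
        rule finite_subset[OF _ fin[of "\<lambda>z. inverse (cmod z)"]])
      (use assms that in auto)
qed

theorem theorem3p4:
  fixes M :: nat and \<theta> :: real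
  assumes "M \<ge> 1"
    and "\<And>z::complex. cmod z = 1 \<Longrightarrow> poly (am_poly M) z \<noteq> 0"
    and "am_rho M < \<theta>" and "\<theta> < 1"
  shows "\<exists>C>0. \<forall>N\<ge>M. \<forall>d\<in>mat_kernel (am_matrix M N). \<forall>i\<le>N.
           \<bar>d $ i\<bar> \<le> C * (\<theta> ^ i * (\<Sum>j=0..M - 1. \<bar>d $ j\<bar>)
                       + \<theta> ^ (N - i) * (\<Sum>j=N - M + 1..N. \<bar>d $ j\<bar>))"
proof -
  have p: "am_poly M \<noteq> 0" using assms(2)[of 1] by auto
  have \<theta>: "0 < \<theta>" using am_rho_nonneg[OF p] assms(3) by simp
  have sep: "norm a < \<theta> \<or> 1 / \<theta> < norm a" if a: "poly (am_poly M) a = 0" for a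
  proof (cases "cmod a < 1")
    case True
    with am_root_le_rho(1)[OF p a] assms(3) show ?thesis by simp
  next
    case False
    moreover have "cmod a \<noteq> 1" using assms(2)[of a] a by blast
    ultimately have "cmod a > 1" by simp
    with am_root_le_rho(2)[OF p a] assms(3) have "inverse (cmod a) < \<theta>" by simp
    moreover have "0 < cmod a" using \<open>cmod a > 1\<close> by linarith
    ultimately have "1 / \<theta> < norm a" using \<theta> by (simp add: field_simps)
    then show ?thesis ..
  qed
  have M: "{0..M - 1} = {..<M}" using assms(1) by auto
  show ?thesis
  proof (rule recurrence_two_sided_decay[OF \<theta> assms(4) p sep degree_am_poly])
    fix C :: real
    assume C: "C > 0" and
      C_le: "\<And>N (x :: nat \<Rightarrow> complex) i. M \<le> N \<Longrightarrow>
        (\<And>n. n \<le> N - M \<Longrightarrow> (\<Sum>k\<le>M. coeff (am_poly M) k * x (n + k)) = 0) \<Longrightarrow> i \<le> N \<Longrightarrow>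
        norm (x i) \<le> C * (\<theta> ^ i * (\<Sum>j<M. norm (x j))
                        + \<theta> ^ (N - i) * (\<Sum>j=N - M + 1..N. norm (x j)))"
    have "\<bar>d $ i\<bar> \<le> C * (\<theta> ^ i * (\<Sum>j=0..M - 1. \<bar>d $ j\<bar>)
                     + \<theta> ^ (N - i) * (\<Sum>j=N - M + 1..N. \<bar>d $ j\<bar>))"
      if N: "M \<le> N" and d: "d \<in> mat_kernel (am_matrix M N)" and i: "i \<le> N" for N d i
      using C_le[of N "\<lambda>j. complex_of_real (d $ j)" i, OF N am_kernel_recurrence[OF N d] i]
      unfolding M by (simp only: norm_of_real)
    with C show ?thesis by blast
  qed
qed

end
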